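(* Suppose that $A$ is a dense alternating sign matrix of size $n$. Then there exist an integer $l$, irreducible dense alternating sign matrices $A_r$, $r=1,2,\ldots,l$, and a permutation $\sigma$ of $\{1,2,\ldots,l\}$ such that $A$ has a block form $$A=\begin{pmatrix} A_{11} & A_{12} & \cdots & A_{1l}\\ A_{21} & A_{22} & \cdots & A_{2l}\\ \vdots&\vdots&&\vdots\\ A_{l1}&A_{l2}&\cdots&A_{ll}\end{pmatrix},$$ where for each $r=1,2,\ldots,l$ we have $A_{r,\sigma(r)}=A_r$ and $A_{rs}=0$ for $s\neq\sigma(r)$. Here $A_r=F_{m_r}^{k_r}$ for some integers $m_r$ and $k_r$ such that $\sum_{r=1}^l m_r=n$ and, for each $r$, either $m_r=k_r=1$ or $m_r\ge3$ and $2\le k_r\le m_r-1$.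
   Context: An alternating sign matrix (ASM) of size $n$ is an $n\times n$ matrix with entries in $\{-1,0,1\}$ such that all initial partial sums along every row and every column lie in $[0,1]$ and every row sum and column sum equals $1$. An ASM is dense if it has no zero entry between any two nonzero entries in a column or in a row. For $n\ge1$ and $1\le k\le n$, $F_n^k$ is the dense ASM whose entries on the four stripes $(k,1),(k-1,2),\ldots,(1,k)$; $(1,k),(2,k+1),\ldots,(n-k+1,n)$; $(n-k+1,n),(n-k+2,n-1),\ldots,(n,n-k+1)$; and $(n,n-k+1),(n-1,n-k),\ldots,(k,1)$ are equal to $1$, all entries enclosed by these stripes are nonzero, and all entries outside are $0$. Explicitly, $(F_n^k)_{ij}=(-1)^{i+j-k-1}$ if $k+1\le i+j\le 2n-k+1$ and $|i-j|\le k-1$, and $(F_n^k)_{ij}=0$ otherwise. A dense ASM is called irreducible if it is the $1\times1$ matrix $[1]$ or equals $F_n^k$ for some $n\ge3$ and $2\le k\le n-1$. In the block form, the $r$-th block row has $m_r$ rows and the $\sigma(r)$-th block column has $m_r$ columns. *)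

theory Defs
  imports
    "Jordan_Normal_Form.Matrix"
    "Jordan_Normal_Form.DL_Submatrix"
    "HOL-Combinatorics.Permutations"
begin

definition alternating_sign_matrix :: "nat \<Rightarrow> int mat \<Rightarrow> bool" where
  "alternating_sign_matrix n A \<longleftrightarrow>
     A \<in> carrier_mat n n \<and>
     elements_mat A \<subseteq> {-1, 0, 1} \<and>
     (\<forall>i<n. \<forall>p\<le>n. (\<Sum>j<p. A $$ (i, j)) \<in> {0..1}) \<and>
     (\<forall>j<n. \<forall>p\<le>n. (\<Sum>i<p. A $$ (i, j)) \<in> {0..1}) \<and>
     (\<forall>i<n. (\<Sum>j<n. A $$ (i, j)) = 1) \<and>
     (\<forall>j<n. (\<Sum>i<n. A $$ (i, j)) = 1)"

definition dense_asm :: "nat \<Rightarrow> int mat \<Rightarrow> bool" where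
  "dense_asm n A \<longleftrightarrow>
     alternating_sign_matrix n A \<and>
     (\<forall>i<n. \<forall>j1 j2 j3. j1 < j2 \<and> j2 < j3 \<and> j3 < n \<and>
        A $$ (i, j1) \<noteq> 0 \<and> A $$ (i, j3) \<noteq> 0 \<longrightarrow> A $$ (i, j2) \<noteq> 0) \<and>
     (\<forall>j<n. \<forall>i1 i2 i3. i1 < i2 \<and> i2 < i3 \<and> i3 < n \<and>
        A $$ (i1, j) \<noteq> 0 \<and> A $$ (i3, j) \<noteq> 0 \<longrightarrow> A $$ (i2, j) \<noteq> 0)"

text \<open>The usual formula for the entries of \<open>F\<^sub>n\<^sup>k\<close> uses row and column indices from \<open>1\<close> to \<open>n\<close>;
  \<open>i\<close> and \<open>j\<close> below are these, shifted from the library's indices \<open>i'\<close>, \<open>j'\<close>, which start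
  at \<open>0\<close>. The first condition keeps the exponent from being truncated. The matrix is meant for
  \<open>1 \<le> k \<le> n\<close> only.\<close>

definition F_mat :: "nat \<Rightarrow> nat \<Rightarrow> int mat" where
  "F_mat n k = mat n n (\<lambda>(i', j').
     let i = Suc i'; j = Suc j' in
     if k + 1 \<le> i + j \<and> i + j \<le> 2 * n - k + 1 \<and> \<bar>int i - int j\<bar> \<le> int k - 1
     then (-1) ^ (i + j - k - 1) else 0)"

definition irreducible_dense_asm :: "int mat \<Rightarrow> bool" where
  "irreducible_dense_asm A \<longleftrightarrow>
     (\<exists>n. dense_asm n A) \<and>
     (A = 1\<^sub>m 1 \<or> (\<exists>n k. 3 \<le> n \<and> 2 \<le> k \<and> k \<le> n - 1 \<and> A = F_mat n k))"

text \<open>The indices belonging to the \<open>r\<close>-th block, if consecutive blocks, numbered from \<open>0\<close>, have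
  sizes \<open>m 0\<close>, \<open>m 1\<close>, and so on.\<close>

definition block_indices :: "(nat \<Rightarrow> nat) \<Rightarrow> nat \<Rightarrow> nat set" where
  "block_indices m r = {(\<Sum>t<r. m t)..<(\<Sum>t<Suc r. m t)}"

definition mat_block :: "'a mat \<Rightarrow> (nat \<Rightarrow> nat) \<Rightarrow> (nat \<Rightarrow> nat) \<Rightarrow> nat \<Rightarrow> nat \<Rightarrow> 'a mat" where
  "mat_block A m c r s = submatrix A (block_indices m r) (block_indices c s)"

end

theory Submission
  imports Defs
begin

text \<open>The support of a row of a dense ASM is an interval \<open>[a, b]\<close> on which the entries alternate.
  Comparing consecutive rows through their columns, either both are single entries (in different
  columns), or both ends of the support move by exactly one step. Since the columns are dense as
  well, a step of \<open>a\<close> to the right is never followed by one to the left, and dually for \<open>b\<close>. Cutting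
  the matrix between any two consecutive single-entry rows therefore gives groups of \<open>m\<close> rows in
  which \<open>a\<close> first decreases and then increases, while \<open>b\<close> first increases and then decreases; both
  start and end with \<open>a = b\<close>, which forces the shape of \<open>F\<^sub>m\<^sup>k\<close>. A column cannot meet two groups, as
  it would contain two vertically adjacent ones.\<close>

section \<open>Integer sequences\<close>

text \<open>Density makes the nonzero positions an interval. A partial sum confined to 0 and 1 has
  to switch value at every nonzero entry, so the entries alternate and begin with 1; the total 1
  forces them to end with 1, which gives the even width.\<close>

lemma dense_alternating_sequence:
  fixes f :: "nat \<Rightarrow> int"
  assumes partial: "\<And>p. p \<le> n \<Longrightarrow> (\<Sum>j<p. f j) \<in> {0..1}"
    and total: "(\<Sum>j<n. f j) = 1"
    and dense: "\<And>j1 j2 j3. j1 < j2 \<Longrightarrow> j2 < j3 \<Longrightarrow> j3 < n \<Longrightarrow> f j1 \<noteq> 0 \<Longrightarrow> f j3 \<noteq> 0 \<Longrightarrow> f j2 \<noteq> 0"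
  shows "\<exists>a b. a \<le> b \<and> b < n \<and> even (b - a) \<and>
    (\<forall>j<n. f j = (if a \<le> j \<and> j \<le> b then (-1) ^ (j - a) else 0))"
proof -
  define S where "S = {j. j < n \<and> f j \<noteq> 0}"
  define a b where "a = Min S" and "b = Max S"
  have fin: "finite S" unfolding S_def by simp
  have "S \<noteq> {}"
  proof
    assume "S = {}"
    then have "(\<Sum>j<n. f j) = 0" unfolding S_def by (intro sum.neutral) auto
    then show False using total by simp
  qed
  then have aS: "a \<in> S" and bS: "b \<in> S" unfolding a_def b_def using fin by auto
  have a_le: "a \<le> j" and le_b: "j \<le> b" if "j \<in> S" for j
    unfolding a_def b_def using fin that by auto
  have ab: "a \<le> b" using a_le bS by blast
  have bn: "b < n" using bS by (auto simp: S_def)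
  have nz: "f j \<noteq> 0" if "a \<le> j" "j \<le> b" for j
    using that dense[of a j b] aS bS by (cases "j = a"; cases "j = b") (auto simp: S_def)
  have z: "f j = 0" if "j < n" "\<not> (a \<le> j \<and> j \<le> b)" for j
    using that a_le[of j] le_b[of j] by (auto simp: S_def)
  have P0: "(\<Sum>j<a. f j) = 0"
    by (intro sum.neutral ballI z) (use ab bn in auto)
  \<comment> \<open>The partial sum before position \<open>a + d\<close> is carried along because
    its value determines the sign of the entry there.\<close>
  have main: "(\<Sum>j<a + d. f j) = (if even d then 0 else 1) \<and> f (a + d) = (-1) ^ d"
    if "a + d \<le> b" for d
    using that
  proof (induction d)
    case 0
    have "f a \<noteq> 0" using nz ab by auto
    moreover have "(\<Sum>j<Suc a. f j) \<in> {0..1}" using partial[of "Suc a"] ab bn by simp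
    ultimately show ?case using P0 by simp
  next
    case (Suc d)
    then have IH: "(\<Sum>j<a + d. f j) = (if even d then 0 else 1)" "f (a + d) = (-1) ^ d" by auto
    have "f (a + Suc d) \<noteq> 0" using nz Suc.prems by auto
    moreover have "(\<Sum>j<Suc (a + Suc d). f j) \<in> {0..1}"
      by (rule partial) (use Suc.prems bn in simp)
    moreover have P: "(\<Sum>j<a + Suc d. f j) = (if even (Suc d) then 0 else 1)"
      using IH by simp
    ultimately show ?case by (auto split: if_splits)
  qed
  have "(\<Sum>j<n. f j) = (\<Sum>j<Suc b. f j)"
    by (rule sum.mono_neutral_right) (use bn z in auto)
  then have "even (b - a)"
    using main[of "b - a"] ab total by (auto split: if_splits)
  moreover have "f j = (-1) ^ (j - a)" if "a \<le> j" "j \<le> b" for j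
    using main[of "j - a"] that by simp
  ultimately show ?thesis using ab bn z by (intro exI[of _ a] exI[of _ b]) auto
qed

text \<open>The second hypothesis says that an upward step is followed by another upward one, so all
  downward steps come first. Their number is \<open>s\<close>, which is also the position of the
  minimum.\<close>

lemma valley_sequence:
  fixes x :: "nat \<Rightarrow> int"
  assumes "\<And>i. Suc i < m \<Longrightarrow> x (Suc i) = x i + 1 \<or> x (Suc i) = x i - 1"
    and "\<And>i. Suc (Suc i) < m \<Longrightarrow> x (Suc i) = x i + 1 \<Longrightarrow> x (Suc (Suc i)) \<noteq> x i"
    and "0 < m"
  shows "\<exists>s<m. \<forall>i<m. x i = x 0 - int s + \<bar>int i - int s\<bar>"
  using assms
proof (induction m)
  case (Suc m)
  show ?case
  proof (cases "m = 0")
    case False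
    have "\<exists>s<m. \<forall>i<m. x i = x 0 - int s + \<bar>int i - int s\<bar>"
      by (rule Suc.IH) (use Suc.prems False in simp_all)
    then obtain s where s: "s < m" "\<And>i. i < m \<Longrightarrow> x i = x 0 - int s + \<bar>int i - int s\<bar>"
      by blast
    obtain m' where m': "m = Suc m'" using False by (cases m) auto
    have step: "x m = x m' + 1 \<or> x m = x m' - 1"
      unfolding m' by (rule Suc.prems(1)) (simp add: m')
    have xm': "x m' = x 0 - int s + \<bar>int m' - int s\<bar>" by (rule s(2)) (simp add: m')
    show ?thesis
    proof (cases "x m = x m' + 1")
      case True
      have "x i = x 0 - int s + \<bar>int i - int s\<bar>" if "i < Suc m" for i
      proof (cases "i = m")
        case im: True
        show ?thesis unfolding im using True xm' m' s(1) by simp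
      next
        case False
        then show ?thesis using that by (intro s(2)) simp
      qed
      then show ?thesis using s(1) less_SucI by blast
    next
      case down: False
      \<comment> \<open>A final downward step is possible only if no upward step came before it, so
        the old minimum sits at the last position \<open>m'\<close>, and the new one moves to
        \<open>m\<close>.\<close>
      have "s = m'"
      proof (rule ccontr)
        assume "s \<noteq> m'"
        then obtain m'' where m'': "m' = Suc m''" "s \<le> m''" using s(1) m' by (cases m') auto
        have xm'': "x m'' = x 0 - int s + \<bar>int m'' - int s\<bar>" by (rule s(2)) (simp add: m' m'')
        have "x (Suc m'') = x m'' + 1" using xm' xm'' m'' by simp
        then have "x (Suc (Suc m'')) \<noteq> x m''" by (intro Suc.prems(2)) (simp_all add: m' m'')
        then show False using m' m'' xm' xm'' step down by simp
      qed
      have "x i = x 0 - int m + \<bar>int i - int m\<bar>" if "i < Suc m" for i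
      proof (cases "i = m")
        case im: True
        show ?thesis unfolding im using down step xm' m' \<open>s = m'\<close> by simp
      next
        case False
        then have "i < m" using that by simp
        then show ?thesis using s(2)[of i] m' \<open>s = m'\<close> by simp
      qed
      then show ?thesis by blast
    qed
  qed auto
qed simp

section \<open>Enumerating a partition into intervals\<close>

text \<open>By induction on the covered length: the interval containing \<open>n - 1\<close> must
  end exactly at \<open>n\<close>, and the others partition what lies before it. The index set is
  kept apart from the starting points \<open>lo\<close>, so that the same blocks can be listed both
  by rows and by columns.\<close>

lemma interval_partition_enumeration:
  fixes lo sz :: "'b \<Rightarrow> nat"
  assumes "finite B"
    and "\<And>b. b \<in> B \<Longrightarrow> 0 < sz b"
    and "\<And>b b'. b \<in> B \<Longrightarrow> b' \<in> B \<Longrightarrow> b \<noteq> b' \<Longrightarrow> {lo b..<lo b + sz b} \<inter> {lo b'..<lo b' + sz b'} = {}"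
    and "(\<Union>b\<in>B. {lo b..<lo b + sz b}) = {..<n}"
  shows "\<exists>f. bij_betw f {..<card B} B \<and> (\<forall>i<card B. (\<Sum>t<i. sz (f t)) = lo (f i)) \<and>
    (\<Sum>t<card B. sz (f t)) = n"
  using assms
proof (induction n arbitrary: B rule: less_induct)
  case (less n)
  show ?case
  proof (cases "n = 0")
    case True
    then have "B = {}" using less.prems(2,4) by fastforce
    then show ?thesis using True by (auto simp: bij_betw_def)
  next
    case False
    then have "n - 1 \<in> (\<Union>b\<in>B. {lo b..<lo b + sz b})" unfolding less.prems(4) by simp
    then obtain b where b: "b \<in> B" "n - 1 \<in> {lo b..<lo b + sz b}" by blast
    have "{lo b..<lo b + sz b} \<subseteq> {..<n}" using less.prems(4) b(1) by blast
    then have end_b: "lo b + sz b = n"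
      using b(2) less.prems(2)[OF b(1)] False by (auto simp: lessThan_atLeast0)
    let ?B = "B - {b}"
    have "(\<Union>b\<in>?B. {lo b..<lo b + sz b}) = (\<Union>b\<in>B. {lo b..<lo b + sz b}) - {lo b..<lo b + sz b}"
      using less.prems(3) b(1) by fastforce
    also have "\<dots> = {..<lo b}" unfolding less.prems(4) using end_b by auto
    finally have "(\<Union>b\<in>?B. {lo b..<lo b + sz b}) = {..<lo b}" .
    moreover have "lo b < n" using end_b less.prems(2)[OF b(1)] by simp
    ultimately obtain f where f: "bij_betw f {..<card ?B} ?B"
      "\<forall>i<card ?B. (\<Sum>t<i. sz (f t)) = lo (f i)" "(\<Sum>t<card ?B. sz (f t)) = lo b"
      using less.IH[of "lo b" ?B] less.prems(1,2,3) by auto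
    \<comment> \<open>The interval split off lies furthest to the right, so it takes the last
      index.\<close>
    define g where "g = f(card ?B := b)"
    have card: "card B = Suc (card ?B)" using b(1) less.prems(1) by (metis card_Suc_Diff1)
    have sums: "(\<Sum>t<i. sz (g t)) = (\<Sum>t<i. sz (f t))" if "i \<le> card ?B" for i
      using that by (intro sum.cong) (auto simp: g_def)
    have "bij_betw g {..<card ?B} ?B"
      using f(1) by (rule bij_betw_cong[THEN iffD1, rotated]) (auto simp: g_def)
    then have "bij_betw g ({..<card ?B} \<union> {card ?B}) (?B \<union> {g (card ?B)})"
      by (intro notIn_Un_bij_betw) (auto simp: g_def)
    then have "bij_betw g {..<card B} B"
      unfolding card lessThan_Suc using b(1) by (simp add: insert_absorb g_def)
    moreover have "(\<Sum>t<i. sz (g t)) = lo (g i)" if "i < card B" for i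
    proof (cases "i = card ?B")
      case True
      then show ?thesis using sums f(3) by (simp add: g_def)
    next
      case ne: False
      then have "i < card ?B" using that card by linarith
      then show ?thesis using sums[of i] f(2) by (simp add: g_def)
    qed
    moreover have "(\<Sum>t<card B. sz (g t)) = n"
      unfolding card using sums f(3) end_b by (simp add: g_def)
    ultimately show ?thesis by blast
  qed
qed


section \<open>Submatrices on intervals\<close>

lemma pick_interval:
  assumes "i < p"
  shows "pick {a..<a + p} i = a + i"
proof -
  have "{x \<in> {a..<a + p}. x < a + i} = {a..<a + i}" using assms by auto
  then show ?thesis using pick_card_in_set[of "a + i" "{a..<a + p}"] assms by simp
qed

lemma submatrix_interval:
  assumes "A \<in> carrier_mat nr nc" "a + p \<le> nr" "b + q \<le> nc"
  shows "submatrix A {a..<a + p} {b..<b + q} = mat p q (\<lambda>(i, j). A $$ (a + i, b + j))"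
proof -
  have "{i. i < dim_row A \<and> i \<in> {a..<a + p}} = {a..<a + p}"
    "{j. j < dim_col A \<and> j \<in> {b..<b + q}} = {b..<b + q}"
    using assms by auto
  then show ?thesis unfolding submatrix_def by (intro eq_matI) (auto simp: pick_interval)
qed

text \<open>Entries of \<open>A\<close> in the rows and columns of the block vanish outside it, so
  partial sums of \<open>B\<close> are partial sums of \<open>A\<close> with leading zeros dropped.
  This later shows that the blocks \<open>F_mat\<close> are dense ASMs without any summation of
  their explicit formula.\<close>

lemma isolated_block_dense_asm:
  assumes A: "dense_asm n A" and B: "B \<in> carrier_mat m m"
    and bounds: "a + m \<le> n" "b + m \<le> n"
    and entry: "\<And>i j. i < m \<Longrightarrow> j < m \<Longrightarrow> B $$ (i, j) = A $$ (a + i, b + j)"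
    and rows: "\<And>i j. i < m \<Longrightarrow> j < n \<Longrightarrow> j \<notin> {b..<b + m} \<Longrightarrow> A $$ (a + i, j) = 0"
    and cols: "\<And>i j. j < m \<Longrightarrow> i < n \<Longrightarrow> i \<notin> {a..<a + m} \<Longrightarrow> A $$ (i, b + j) = 0"
  shows "dense_asm m B"
proof -
  have asm: "alternating_sign_matrix n A" using A by (simp add: dense_asm_def)
  have shift: "(\<Sum>j<p. f (c + j)) = (\<Sum>j<c + p. f j)"
    if "\<And>j. j < c \<Longrightarrow> f j = 0" for f :: "nat \<Rightarrow> int" and c p
    using that by (induction p) auto
  have row_sum: "(\<Sum>j<p. B $$ (i, j)) = (\<Sum>j<b + p. A $$ (a + i, j))" if "i < m" "p \<le> m" for i p
  proof -
    have "(\<Sum>j<p. B $$ (i, j)) = (\<Sum>j<p. A $$ (a + i, b + j))"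
      using that entry by (intro sum.cong) auto
    also have "\<dots> = (\<Sum>j<b + p. A $$ (a + i, j))"
      by (rule shift) (use that rows bounds in auto)
    finally show ?thesis .
  qed
  have col_sum: "(\<Sum>i<p. B $$ (i, j)) = (\<Sum>i<a + p. A $$ (i, b + j))" if "j < m" "p \<le> m" for j p
  proof -
    have "(\<Sum>i<p. B $$ (i, j)) = (\<Sum>i<p. A $$ (a + i, b + j))"
      using that entry by (intro sum.cong) auto
    also have "\<dots> = (\<Sum>i<a + p. A $$ (i, b + j))"
      by (rule shift) (use that cols bounds in auto)
    finally show ?thesis .
  qed
  have elements: "elements_mat B \<subseteq> elements_mat A"
  proof
    fix x assume "x \<in> elements_mat B"
    then obtain i j where "i < m" "j < m" "x = B $$ (i, j)" using B by auto
    moreover have "A \<in> carrier_mat n n" using asm by (simp add: alternating_sign_matrix_def)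
    ultimately show "x \<in> elements_mat A"
      using entry bounds by (intro elements_matI[of A n n "a + i" "b + j"]) auto
  qed
  have row_total: "(\<Sum>j<m. B $$ (i, j)) = 1" if "i < m" for i
  proof -
    have "(\<Sum>j<b + m. A $$ (a + i, j)) = (\<Sum>j<n. A $$ (a + i, j))"
      by (rule sum.mono_neutral_left) (use that rows bounds in auto)
    then show ?thesis using row_sum[of i m] that asm bounds by (simp add: alternating_sign_matrix_def)
  qed
  have col_total: "(\<Sum>i<m. B $$ (i, j)) = 1" if "j < m" for j
  proof -
    have "(\<Sum>i<a + m. A $$ (i, b + j)) = (\<Sum>i<n. A $$ (i, b + j))"
      by (rule sum.mono_neutral_left) (use that cols bounds in auto)
    then show ?thesis using col_sum[of j m] that asm bounds by (simp add: alternating_sign_matrix_def)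
  qed
  have row_partial: "(\<Sum>j<p. B $$ (i, j)) \<in> {0..1}" if "i < m" "p \<le> m" for i p
    using row_sum[OF that] that asm bounds by (simp add: alternating_sign_matrix_def)
  have col_partial: "(\<Sum>i<p. B $$ (i, j)) \<in> {0..1}" if "j < m" "p \<le> m" for j p
    using col_sum[OF that] that asm bounds by (simp add: alternating_sign_matrix_def)
  have "elements_mat B \<subseteq> {-1, 0, 1}"
    using elements asm unfolding alternating_sign_matrix_def by (meson subset_trans)
  then have "alternating_sign_matrix m B"
    unfolding alternating_sign_matrix_def
    by (intro conjI allI impI B row_total col_total row_partial col_partial)
  moreover have "B $$ (i, j2) \<noteq> 0"
    if "i < m" "j1 < j2" "j2 < j3" "j3 < m" "B $$ (i, j1) \<noteq> 0" "B $$ (i, j3) \<noteq> 0" for i j1 j2 j3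
  proof -
    have "A $$ (a + i, b + j2) \<noteq> 0 \<or> \<not> (a + i < n \<and> b + j1 < b + j2 \<and> b + j2 < b + j3 \<and> b + j3 < n \<and>
        A $$ (a + i, b + j1) \<noteq> 0 \<and> A $$ (a + i, b + j3) \<noteq> 0)"
      using A unfolding dense_asm_def by blast
    then show ?thesis using that entry bounds by auto
  qed
  moreover have "B $$ (i2, j) \<noteq> 0"
    if "j < m" "i1 < i2" "i2 < i3" "i3 < m" "B $$ (i1, j) \<noteq> 0" "B $$ (i3, j) \<noteq> 0" for j i1 i2 i3
  proof -
    have "A $$ (a + i2, b + j) \<noteq> 0 \<or> \<not> (b + j < n \<and> a + i1 < a + i2 \<and> a + i2 < a + i3 \<and> a + i3 < n \<and>
        A $$ (a + i1, b + j) \<noteq> 0 \<and> A $$ (a + i3, b + j) \<noteq> 0)"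
      using A unfolding dense_asm_def by blast
    then show ?thesis using that entry bounds by auto
  qed
  ultimately show ?thesis unfolding dense_asm_def by blast
qed

section \<open>The matrices \<open>F_mat\<close>\<close>

text \<open>Solving the four linear conditions for \<open>j\<close> describes each row by its two
  ends: the left end is a valley in \<open>i\<close> with minimum at \<open>s\<close>, the right end
  a peak with maximum at \<open>t\<close>. This is the form in which the supports arise from
  \<open>valley_sequence\<close>.\<close>

lemma F_mat_index:
  assumes "m = s + t + 1" "i < m" "j < m"
  shows "F_mat m (s + 1) $$ (i, j) =
    (if \<bar>int i - int s\<bar> \<le> int j \<and> int j \<le> int (s + t) - \<bar>int i - int t\<bar>
     then (-1) ^ nat (int j - \<bar>int i - int s\<bar>) else 0)"
proof -
  have "2 * m - (s + 1) + 1 = s + 2 * t + 2" using assms(1) by simp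
  moreover have "int j \<le> int (s + t) - \<bar>int i - int t\<bar> \<longleftrightarrow> \<bar>int i - int t\<bar> \<le> int (s + t) - int j"
    by linarith
  ultimately have "(s + 1 + 1 \<le> Suc i + Suc j \<and> Suc i + Suc j \<le> 2 * m - (s + 1) + 1 \<and>
      \<bar>int (Suc i) - int (Suc j)\<bar> \<le> int (s + 1) - 1) \<longleftrightarrow>
    \<bar>int i - int s\<bar> \<le> int j \<and> int j \<le> int (s + t) - \<bar>int i - int t\<bar>"
    unfolding abs_le_iff by (simp only:) (rule iffI; elim conjE; intro conjI; linarith)
  moreover have "(-1 :: int) ^ (Suc i + Suc j - (s + 1) - 1) = (-1) ^ nat (int j - \<bar>int i - int s\<bar>)"
    if "\<bar>int i - int s\<bar> \<le> int j"
  proof -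
    \<comment> \<open>The two exponents differ by an even number. For \<open>i < s\<close> they
      agree, as the truncated \<open>i - s\<close> is then 0.\<close>
    have "Suc i + Suc j - (s + 1) - 1 = nat (int j - \<bar>int i - int s\<bar>) + 2 * (i - s)"
      using that by linarith
    then show ?thesis by (simp only: power_add power_mult) simp
  qed
  ultimately show ?thesis using assms unfolding F_mat_def by (auto simp: Let_def)
qed

lemma F_mat_column_nonzero:
  assumes "m = s + t + 1" "j < m"
  shows "\<exists>i<m. F_mat m (s + 1) $$ (i, j) \<noteq> 0"
proof -
  \<comment> \<open>The shape is symmetric in rows and columns, so this is the row in which the
    support of column \<open>j\<close> begins.\<close>
  define i where "i = nat \<bar>int j - int s\<bar>"
  have "i < m" using assms by (auto simp: i_def)
  moreover have "\<bar>int i - int s\<bar> \<le> int j \<and> int j \<le> int (s + t) - \<bar>int i - int t\<bar>"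
    using assms unfolding i_def by arith
  ultimately show ?thesis using F_mat_index[OF assms(1) _ assms(2), of i] by (auto intro: exI[of _ i])
qed


section \<open>The rows of a dense alternating sign matrix\<close>

lemma dense_asm_row:
  assumes "dense_asm n A" "i < n"
  shows "\<exists>a b. a \<le> b \<and> b < n \<and> even (b - a) \<and>
    (\<forall>j<n. A $$ (i, j) = (if a \<le> j \<and> j \<le> b then (-1) ^ (j - a) else 0))"
proof (rule dense_alternating_sequence)
  show "A $$ (i, j2) \<noteq> 0"
    if "j1 < j2" "j2 < j3" "j3 < n" "A $$ (i, j1) \<noteq> 0" "A $$ (i, j3) \<noteq> 0" for j1 j2 j3
    using assms that unfolding dense_asm_def by blast
qed (use assms in \<open>simp_all add: dense_asm_def alternating_sign_matrix_def\<close>)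

lemma dense_asm_column:
  assumes "dense_asm n A" "j < n"
  shows "\<exists>a b. a \<le> b \<and> b < n \<and> even (b - a) \<and>
    (\<forall>i<n. A $$ (i, j) = (if a \<le> i \<and> i \<le> b then (-1) ^ (i - a) else 0))"
proof (rule dense_alternating_sequence)
  show "A $$ (i2, j) \<noteq> 0"
    if "i1 < i2" "i2 < i3" "i3 < n" "A $$ (i1, j) \<noteq> 0" "A $$ (i3, j) \<noteq> 0" for i1 i2 i3
    using assms that unfolding dense_asm_def by blast
qed (use assms in \<open>simp_all add: dense_asm_def alternating_sign_matrix_def\<close>)

text \<open>The functions \<open>a\<close> and \<open>b\<close> trace the left and right boundary of
  the support; the argument consists in following them from row to row.\<close>

locale dense_asm_rows =
  fixes n :: nat and A :: "int mat" and a b :: "nat \<Rightarrow> nat"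
  assumes dense: "dense_asm n A"
    and a_le_b: "i < n \<Longrightarrow> a i \<le> b i"
    and b_less: "i < n \<Longrightarrow> b i < n"
    and even_width: "i < n \<Longrightarrow> even (b i - a i)"
    and entry: "i < n \<Longrightarrow> j < n \<Longrightarrow>
      A $$ (i, j) = (if a i \<le> j \<and> j \<le> b i then (-1) ^ (j - a i) else 0)"
begin

text \<open>The nonzero stretch of a column alternates and has a 1 at both ends, so a -1 lies
  strictly inside it.\<close>

lemma minus_one_between:
  assumes "i < n" "j < n" "A $$ (i, j) = -1"
  shows "0 < i \<and> A $$ (i - 1, j) = 1 \<and> Suc i < n \<and> A $$ (Suc i, j) = 1"
proof -
  obtain c d where cd: "c \<le> d" "d < n" "even (d - c)"
    "\<And>i. i < n \<Longrightarrow> A $$ (i, j) = (if c \<le> i \<and> i \<le> d then (-1) ^ (i - c) else 0)"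
    using dense_asm_column[OF dense assms(2)] by auto
  have i: "c \<le> i" "i \<le> d" "odd (i - c)"
    using cd(4)[OF assms(1)] assms(3) by (auto simp: minus_one_power_iff split: if_splits)
  then have "c < i" "i < d" using cd(3) by (metis diff_self_eq_0 even_zero le_neq_implies_less)+
  then show ?thesis
    using cd(4)[of "i - 1"] cd(4)[of "Suc i"] i cd(2) by (auto simp: minus_one_power_iff Suc_diff_le)
qed

lemma not_adjacent_ones:
  assumes "Suc i < n" "j < n" "A $$ (i, j) = 1"
  shows "A $$ (Suc i, j) \<noteq> 1"
proof -
  obtain c d where "\<And>i. i < n \<Longrightarrow> A $$ (i, j) = (if c \<le> i \<and> i \<le> d then (-1) ^ (i - c) else 0)"
    using dense_asm_column[OF dense assms(2)] by auto
  from this[of i] this[of "Suc i"] show ?thesis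
    using assms by (auto simp: Suc_diff_le split: if_splits)
qed

lemma nonzero_iff: "i < n \<Longrightarrow> j < n \<Longrightarrow> A $$ (i, j) \<noteq> 0 \<longleftrightarrow> a i \<le> j \<and> j \<le> b i"
  by (simp add: entry)

lemma one_iff: "i < n \<Longrightarrow> j < n \<Longrightarrow> A $$ (i, j) = 1 \<longleftrightarrow> a i \<le> j \<and> j \<le> b i \<and> even (j - a i)"
  by (auto simp: entry minus_one_power_iff)

lemma minus_one_iff: "i < n \<Longrightarrow> j < n \<Longrightarrow> A $$ (i, j) = -1 \<longleftrightarrow> a i \<le> j \<and> j \<le> b i \<and> odd (j - a i)"
  by (auto simp: entry minus_one_power_iff)

lemma column_dense:
  assumes "i1 \<le> i2" "i2 \<le> i3" "i3 < n" "j < n" "A $$ (i1, j) \<noteq> 0" "A $$ (i3, j) \<noteq> 0"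
  shows "A $$ (i2, j) \<noteq> 0"
proof (cases "i1 = i2 \<or> i2 = i3")
  case False
  then have "i1 < i2" "i2 < i3" using assms by auto
  then show ?thesis using dense assms unfolding dense_asm_def by blast
qed (use assms in auto)

section \<open>The ends of the supports in consecutive rows\<close>

definition single :: "nat \<Rightarrow> bool" where
  "single i \<longleftrightarrow> a i = b i"

lemma wide_width: "i < n \<Longrightarrow> \<not> single i \<Longrightarrow> a i + 2 \<le> b i"
proof -
  assume i: "i < n" "\<not> single i"
  have "b i - a i \<noteq> 0" using i a_le_b[of i] by (auto simp: single_def)
  moreover have "b i - a i \<noteq> 1" using even_width[OF i(1)] by (metis odd_one)
  ultimately show ?thesis by linarith
qed

lemma wide_minus_ones:
  assumes "i < n" "\<not> single i"
  shows "A $$ (i, a i + 1) = -1" "A $$ (i, b i - 1) = -1"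
proof -
  have w: "a i + 2 \<le> b i" using wide_width assms by blast
  moreover have "odd (b i - 1 - a i)"
  proof -
    have "b i - a i = Suc (b i - 1 - a i)" using w by simp
    then show ?thesis using even_width[OF assms(1)] by simp
  qed
  ultimately show "A $$ (i, a i + 1) = -1" "A $$ (i, b i - 1) = -1"
    using b_less[OF assms(1)] assms(1) by (auto simp: minus_one_iff)
qed

text \<open>A wider row contains a -1, which needs a 1 in the row above it as well as in the row
  below it. The same reason applies to the last row.\<close>

lemma single_first: "0 < n \<Longrightarrow> single 0"
  using wide_minus_ones(1)[of 0] minus_one_between[of 0 "a 0 + 1"] wide_width[of 0] b_less[of 0]
  by fastforce

lemma single_last: "0 < n \<Longrightarrow> single (n - 1)"
  using wide_minus_ones(1)[of "n - 1"] minus_one_between[of "n - 1" "a (n - 1) + 1"]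
    wide_width[of "n - 1"] b_less[of "n - 1"]
  by fastforce

text \<open>The second and the last but one entry of a wide row are -1, so both neighbouring rows
  have a 1 in these columns. Their supports must reach that far, and the parity of the left end is
  fixed too.\<close>

lemma wide_covered:
  assumes "i < n" "i' < n" "i' = Suc i \<or> i = Suc i'" "\<not> single i"
  shows "a i' \<le> a i + 1" "b i \<le> b i' + 1" "even (a i + 1 - a i')"
proof -
  have w: "a i + 2 \<le> b i" "b i < n" using wide_width b_less assms by blast+
  have "A $$ (i', a i + 1) = 1" "A $$ (i', b i - 1) = 1"
    using minus_one_between[of i "a i + 1"] minus_one_between[of i "b i - 1"]
      wide_minus_ones[OF assms(1,4)] assms w by auto
  then show "a i' \<le> a i + 1" "b i \<le> b i' + 1" "even (a i + 1 - a i')"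
    using one_iff[OF assms(2)] w by auto
qed

lemma consecutive_rows:
  assumes i: "Suc i < n" and wide: "\<not> (single i \<and> single (Suc i))"
  shows "a (Suc i) = a i + 1 \<or> a i = a (Suc i) + 1"
    and "b (Suc i) = b i + 1 \<or> b i = b (Suc i) + 1"
proof -
  have i': "i < n" using i by simp
  have le: "a i \<le> b i" "a (Suc i) \<le> b (Suc i)" using a_le_b i by auto
  have par: "even (b i - a i)" "even (b (Suc i) - a (Suc i))" using even_width i by auto
  have up: "a (Suc i) \<le> a i + 1 \<and> b i \<le> b (Suc i) + 1 \<and> even (a i + 1 - a (Suc i)) \<and> a i + 2 \<le> b i"
    if "\<not> single i"
    using wide_covered[of i "Suc i"] wide_width[OF i' that] i i' that by auto
  have down: "a i \<le> a (Suc i) + 1 \<and> b (Suc i) \<le> b i + 1 \<and> even (a (Suc i) + 1 - a i) \<and>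
      a (Suc i) + 2 \<le> b (Suc i)"
    if "\<not> single (Suc i)"
    using wide_covered[of "Suc i" i] wide_width[OF i that] i i' that by auto
  consider "\<not> single i" "\<not> single (Suc i)" | "\<not> single i" "single (Suc i)" | "single i" "\<not> single (Suc i)"
    using wide by blast
  then have "(a (Suc i) = a i + 1 \<or> a i = a (Suc i) + 1) \<and> (b (Suc i) = b i + 1 \<or> b i = b (Suc i) + 1)"
  proof cases
    case 1
    note u = up[OF 1(1)] and d = down[OF 1(2)]
    have "a (Suc i) \<noteq> a i" using u by auto
    then have a: "a (Suc i) = a i + 1 \<or> a i = a (Suc i) + 1" using u d by linarith
    \<comment> \<open>In each row \<open>a\<close> and \<open>b\<close> have the same parity, and
      \<open>a\<close> has just changed by one.\<close>
    moreover have "b (Suc i) \<noteq> b i" using a par le by auto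
    ultimately show ?thesis using u d by linarith
  next
    case 2
    \<comment> \<open>The only column of the single row is at most \<open>a i + 1\<close> and at
      least \<open>b i - 1\<close>; since \<open>a i + 2 \<le> b i\<close>, equality holds
      throughout.\<close>
    then show ?thesis using up[OF 2(1)] by (auto simp: single_def)
  next
    case 3
    then show ?thesis using down[OF 3(2)] by (auto simp: single_def)
  qed
  then show "a (Suc i) = a i + 1 \<or> a i = a (Suc i) + 1"
    and "b (Suc i) = b i + 1 \<or> b i = b (Suc i) + 1"
    by auto
qed

text \<open>Otherwise column \<open>a i\<close> would be nonzero in rows \<open>i\<close> and
  \<open>i + 2\<close> but zero in the row between them, against density of the column.\<close>

lemma a_no_peak:
  assumes "Suc (Suc i) < n" "a (Suc i) = a i + 1"
  shows "a (Suc (Suc i)) \<noteq> a i"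
proof
  assume eq: "a (Suc (Suc i)) = a i"
  have "a i < n" using a_le_b[of i] b_less[of i] assms(1) by simp
  then have "A $$ (Suc i, a i) \<noteq> 0"
    using a_le_b[of i] a_le_b[of "Suc (Suc i)"] assms(1) eq
    by (intro column_dense[of i "Suc i" "Suc (Suc i)"]) (auto simp: nonzero_iff)
  then show False using assms \<open>a i < n\<close> by (auto simp: nonzero_iff)
qed

lemma b_no_valley:
  assumes "Suc (Suc i) < n" "b i = b (Suc i) + 1"
  shows "b (Suc (Suc i)) \<noteq> b i"
proof
  assume eq: "b (Suc (Suc i)) = b i"
  have "b i < n" using b_less[of i] assms(1) by simp
  then have "A $$ (Suc i, b i) \<noteq> 0"
    using a_le_b[of i] a_le_b[of "Suc (Suc i)"] assms(1) eq
    by (intro column_dense[of i "Suc i" "Suc (Suc i)"]) (auto simp: nonzero_iff)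
  then show False using assms \<open>b i < n\<close> by (auto simp: nonzero_iff)
qed

text \<open>Both ends of the support follow \<open>valley_sequence\<close>, the right end after a
  change of sign. The parameters \<open>s\<close> and \<open>t\<close> are the rows, counted from
  \<open>e\<close>, where the left end is smallest and the right end is largest.\<close>

lemma block_shape:
  assumes m: "0 < m" "e + m \<le> n"
    and first: "single e" and last: "single (e + m - 1)"
    and uncut: "\<And>i. Suc i < m \<Longrightarrow> \<not> (single (e + i) \<and> single (Suc (e + i)))"
  shows "\<exists>s t lo. m = s + t + 1 \<and> (m = 1 \<or> 0 < s \<and> 0 < t) \<and> lo + m \<le> n \<and>
    (\<forall>i<m. \<forall>j<n. A $$ (e + i, j) =
      (if lo \<le> j \<and> j < lo + m then F_mat m (s + 1) $$ (i, j - lo) else 0))"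
proof -
  define x where "x i = int (a (e + i))" for i
  \<comment> \<open>Negation turns the peak of \<open>b\<close> into a valley, so that one lemma
    serves both ends.\<close>
  define y where "y i = - int (b (e + i))" for i
  have x_step: "x (Suc i) = x i + 1 \<or> x (Suc i) = x i - 1" if "Suc i < m" for i
    using consecutive_rows(1)[of "e + i"] uncut[OF that] that m unfolding x_def by auto
  have y_step: "y (Suc i) = y i + 1 \<or> y (Suc i) = y i - 1" if "Suc i < m" for i
    using consecutive_rows(2)[of "e + i"] uncut[OF that] that m unfolding y_def by auto
  have x_turn: "x (Suc (Suc i)) \<noteq> x i" if "Suc (Suc i) < m" "x (Suc i) = x i + 1" for i
    using a_no_peak[of "e + i"] that m unfolding x_def by auto
  have y_turn: "y (Suc (Suc i)) \<noteq> y i" if "Suc (Suc i) < m" "y (Suc i) = y i + 1" for i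
    using b_no_valley[of "e + i"] that m unfolding y_def by auto
  obtain s where s: "s < m" and x: "\<And>i. i < m \<Longrightarrow> x i = x 0 - int s + \<bar>int i - int s\<bar>"
    using valley_sequence[of m x, OF x_step x_turn m(1)] by blast
  obtain t where t: "t < m" and y: "\<And>i. i < m \<Longrightarrow> y i = y 0 - int t + \<bar>int i - int t\<bar>"
    using valley_sequence[of m y, OF y_step y_turn m(1)] by blast
  have start: "y 0 = - x 0" using first by (simp add: x_def y_def single_def)
  have "y (m - 1) = - x (m - 1)" using last m by (simp add: x_def y_def single_def)
  \<comment> \<open>Both ends meet in the first and in the last row; subtracting the two relations
    leaves \<open>m - 1 = s + t\<close>.\<close>
  then have mst: "m = s + t + 1"
    using x[of "m - 1"] y[of "m - 1"] start s t by simp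
  have "x s = x 0 - int s" using x[OF s] by simp
  then have "int s \<le> int (a e)" by (simp add: x_def)
  \<comment> \<open>\<open>lo\<close> is the minimum of the left end, attained in row
    \<open>e + s\<close>, and hence the first column of the block.\<close>
  then obtain lo where lo: "a e = lo + s" by (metis of_nat_le_iff le_add_diff_inverse2)
  have xi: "int (a (e + i)) = int lo + \<bar>int i - int s\<bar>" if "i < m" for i
    using x[OF that] lo by (simp add: x_def)
  have yi: "int (b (e + i)) = int lo + int s + int t - \<bar>int i - int t\<bar>" if "i < m" for i
    using y[OF that] lo start by (simp add: x_def y_def)
  \<comment> \<open>In row \<open>e + t\<close> the right end attains its maximum
    \<open>lo + s + t\<close>, the last column of the block.\<close>
  have "lo + m \<le> n" using yi[OF t] b_less[of "e + t"] t m mst by simp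
  moreover have "m = 1 \<or> 0 < s \<and> 0 < t"
  proof (rule ccontr)
    assume "\<not> ?thesis"
    then have m1: "1 < m" and st: "s = 0 \<or> t = 0" using m(1) by auto
    \<comment> \<open>If \<open>s = 0\<close> or \<open>t = 0\<close>, both ends move in the same
      direction from the start, so row \<open>e + 1\<close> is single like row \<open>e\<close> and
      there would be a cut between them.\<close>
    have "a (e + 1) = b (e + 1)"
      using st xi[OF m1] yi[OF m1] a_le_b[of "e + 1"] m m1 mst by (cases s; cases t) auto
    then show False using uncut[of 0] first m1 by (simp add: single_def)
  qed
  moreover have "A $$ (e + i, j) = (if lo \<le> j \<and> j < lo + m then F_mat m (s + 1) $$ (i, j - lo) else 0)"
    if i: "i < m" and j: "j < n" for i j
  proof (cases "lo \<le> j \<and> j < lo + m")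
    case True
    have "a (e + i) \<le> j \<and> j \<le> b (e + i) \<longleftrightarrow>
      \<bar>int i - int s\<bar> \<le> int (j - lo) \<and> int (j - lo) \<le> int (s + t) - \<bar>int i - int t\<bar>"
      using xi[OF i] yi[OF i] True by linarith
    moreover have "j - a (e + i) = nat (int (j - lo) - \<bar>int i - int s\<bar>)" if "a (e + i) \<le> j"
      using xi[OF i] True that by linarith
    ultimately show ?thesis
      using True i j m entry[of "e + i" j] F_mat_index[OF mst i, of "j - lo"] by auto
  next
    case False
    then have "\<not> (a (e + i) \<le> j \<and> j \<le> b (e + i))" using xi[OF i] yi[OF i] mst by linarith
    then show ?thesis using False entry[of "e + i" j] i j m by auto
  qed
  ultimately show ?thesis using mst by blast
qed

section \<open>Cutting the rows into groups\<close>

definition cut :: "nat \<Rightarrow> bool" where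
  "cut e \<longleftrightarrow> e = 0 \<or> single (e - 1) \<and> single e"

definition starts :: "nat set" where
  "starts = {e. e < n \<and> cut e}"

definition next_start :: "nat \<Rightarrow> nat" where
  "next_start e = (LEAST e'. e < e' \<and> (e' = n \<or> cut e'))"

lemma next_start:
  assumes "e < n"
  shows "e < next_start e" "next_start e \<le> n" "next_start e = n \<or> cut (next_start e)"
    and "\<And>e'. e < e' \<Longrightarrow> e' < next_start e \<Longrightarrow> \<not> cut e'"
proof -
  have n: "e < n \<and> (n = n \<or> cut n)" using assms by simp
  show "e < next_start e" "next_start e = n \<or> cut (next_start e)"
    using LeastI[of "\<lambda>e'. e < e' \<and> (e' = n \<or> cut e')", OF n] unfolding next_start_def by blast+
  show "next_start e \<le> n"
    using Least_le[of "\<lambda>e'. e < e' \<and> (e' = n \<or> cut e')", OF n] unfolding next_start_def .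
  show "\<not> cut e'" if "e < e'" "e' < next_start e" for e'
    using not_less_Least[of e' "\<lambda>e'. e < e' \<and> (e' = n \<or> cut e')"] that unfolding next_start_def by blast
qed

text \<open>The group of row \<open>i\<close> begins at the greatest cut not after \<open>i\<close>,
  which exists because 0 is a cut. If the group ended by \<open>i\<close>, its end would be a
  greater such cut.\<close>

lemma starts_cover:
  assumes "i < n"
  shows "\<exists>e\<in>starts. e \<le> i \<and> i < next_start e"
proof -
  define e where "e = (GREATEST e. e \<le> i \<and> cut e)"
  have e: "e \<le> i \<and> cut e"
    unfolding e_def by (rule GreatestI_nat[of _ 0 i]) (auto simp: cut_def)
  have "i < next_start e"
  proof (rule ccontr)
    assume "\<not> i < next_start e"
    moreover have "e < n" using e assms by simp
    ultimately have "next_start e \<le> i \<and> cut (next_start e)" using next_start[of e] assms by auto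
    then have "next_start e \<le> e" unfolding e_def by (intro Greatest_le_nat[of _ _ i]) auto
    then show False using next_start(1)[OF \<open>e < n\<close>] by simp
  qed
  moreover have "e < n" using e assms by simp
  ultimately show ?thesis using e by (auto simp: starts_def)
qed

lemma starts_separated:
  assumes "e \<in> starts" "e' \<in> starts" "e < e'"
  shows "next_start e \<le> e'"
  using next_start(4)[of e e'] assms by (force simp: starts_def)

lemma starts_block_shape:
  assumes "e \<in> starts" and m: "m = next_start e - e"
  shows "\<exists>s t lo. m = s + t + 1 \<and> (m = 1 \<or> 0 < s \<and> 0 < t) \<and> lo + m \<le> n \<and>
    (\<forall>i<m. \<forall>j<n. A $$ (e + i, j) =
      (if lo \<le> j \<and> j < lo + m then F_mat m (s + 1) $$ (i, j - lo) else 0))"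
proof (rule block_shape)
  have e: "e < n" "cut e" using assms(1) by (auto simp: starts_def)
  note ns = next_start[OF e(1)]
  show "0 < m" "e + m \<le> n" using ns(1,2) m by auto
  show "single e" using e single_first by (auto simp: cut_def)
  have "single (next_start e - 1)" using ns(1,3) single_last e(1) by (auto simp: cut_def)
  then show "single (e + m - 1)" using ns(1) m by simp
  show "\<not> (single (e + i) \<and> single (Suc (e + i)))" if "Suc i < m" for i
    using ns(4)[of "Suc (e + i)"] that m by (auto simp: cut_def)
qed

text \<open>A column meeting both sides of a cut is nonzero in the two single rows next to it, which
  puts two ones on top of each other.\<close>

lemma column_not_across:
  assumes "e \<in> starts" "i < e" "e \<le> i'" "i' < n" "j < n" "A $$ (i, j) \<noteq> 0"
  shows "A $$ (i', j) = 0"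
proof (rule ccontr)
  assume i': "A $$ (i', j) \<noteq> 0"
  have s: "single (e - 1)" "single e" using assms(1,2) by (auto simp: starts_def cut_def)
  have "A $$ (e - 1, j) \<noteq> 0" "A $$ (e, j) \<noteq> 0"
    using column_dense[OF _ _ assms(4,5,6) i'] assms(2,3) by auto
  then have "A $$ (e - 1, j) = 1" "A $$ (e, j) = 1"
    using s assms(3-5) by (auto simp: nonzero_iff one_iff single_def)
  then show False using not_adjacent_ones[of "e - 1" j] assms(2-5) by auto
qed

end

lemma dense_asm_rows_exist:
  assumes "dense_asm n A"
  shows "\<exists>a b. dense_asm_rows n A a b"
proof -
  define R where "R i a b \<longleftrightarrow> a \<le> b \<and> b < n \<and> even (b - a) \<and>
    (\<forall>j<n. A $$ (i, j) = (if a \<le> j \<and> j \<le> b then (-1) ^ (j - a) else 0))" for i a b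
  have "\<exists>a b. R i a b" if "i < n" for i
    unfolding R_def by (rule dense_asm_row[OF assms that])
  then obtain a b where "\<And>i. i < n \<Longrightarrow> R i (a i) (b i)" by metis
  then have "dense_asm_rows n A a b" using assms unfolding R_def by (intro dense_asm_rows.intro) simp_all
  then show ?thesis by blast
qed

section \<open>The block form\<close>

text \<open>Collects the geometry without the locale. A block is named by its first row
  \<open>e\<close>; \<open>lo e\<close> is its first column and \<open>sz e\<close> its size. The
  names \<open>e\<close> and the values \<open>lo e\<close> thus order the same blocks in two
  ways.\<close>

lemma dense_asm_block_decomposition:
  assumes A: "dense_asm n A"
  obtains B sz lo k where "finite B"
    and "\<And>e. e \<in> B \<Longrightarrow> e + sz e \<le> n" "\<And>e. e \<in> B \<Longrightarrow> lo e + sz e \<le> n"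
    and "\<And>e. e \<in> B \<Longrightarrow> sz e = 1 \<and> k e = 1 \<or> 3 \<le> sz e \<and> 2 \<le> k e \<and> k e \<le> sz e - 1"
    and "\<And>e i j. e \<in> B \<Longrightarrow> i < sz e \<Longrightarrow> j < n \<Longrightarrow> A $$ (e + i, j) =
      (if lo e \<le> j \<and> j < lo e + sz e then F_mat (sz e) (k e) $$ (i, j - lo e) else 0)"
    and "\<And>e e'. e \<in> B \<Longrightarrow> e' \<in> B \<Longrightarrow> e \<noteq> e' \<Longrightarrow> {e..<e + sz e} \<inter> {e'..<e' + sz e'} = {}"
    and "\<And>e e'. e \<in> B \<Longrightarrow> e' \<in> B \<Longrightarrow> e \<noteq> e' \<Longrightarrow>
      {lo e..<lo e + sz e} \<inter> {lo e'..<lo e' + sz e'} = {}"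
    and "(\<Union>e\<in>B. {e..<e + sz e}) = {..<n}"
    and "(\<Union>e\<in>B. {lo e..<lo e + sz e}) = {..<n}"
proof -
  obtain a b where "dense_asm_rows n A a b" using dense_asm_rows_exist[OF A] by blast
  then interpret dense_asm_rows n A a b .
  define sz where "sz e = next_start e - e" for e
  have "\<exists>s t lo. e \<in> starts \<longrightarrow> sz e = s + t + 1 \<and> (sz e = 1 \<or> 0 < s \<and> 0 < t) \<and> lo + sz e \<le> n \<and>
    (\<forall>i<sz e. \<forall>j<n. A $$ (e + i, j) =
      (if lo \<le> j \<and> j < lo + sz e then F_mat (sz e) (s + 1) $$ (i, j - lo) else 0))" for e
    using starts_block_shape[of e "sz e"] sz_def by blast
  then obtain s t lo where shape: "\<And>e. e \<in> starts \<Longrightarrow>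
      sz e = s e + t e + 1 \<and> (sz e = 1 \<or> 0 < s e \<and> 0 < t e) \<and> lo e + sz e \<le> n"
    and block: "\<And>e i j. e \<in> starts \<Longrightarrow> i < sz e \<Longrightarrow> j < n \<Longrightarrow> A $$ (e + i, j) =
      (if lo e \<le> j \<and> j < lo e + sz e then F_mat (sz e) (s e + 1) $$ (i, j - lo e) else 0)"
    by metis
  have end_e: "e + sz e = next_start e" "e + sz e \<le> n" if "e \<in> starts" for e
    using next_start(1,2)[of e] that by (auto simp: sz_def starts_def)
  \<comment> \<open>Every column in the range of a group is really met by that group. Overlapping
    ranges would therefore give a column that crosses a cut.\<close>
  have column_hit: "\<exists>i<sz e. A $$ (e + i, j) \<noteq> 0"
    if e: "e \<in> starts" and j: "j \<in> {lo e..<lo e + sz e}" for e j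
  proof -
    have "sz e = s e + t e + 1" "j - lo e < sz e" "j < n" using shape[OF e] j by auto
    then show ?thesis using F_mat_column_nonzero[of "sz e" "s e" "t e" "j - lo e"] block[OF e] j by auto
  qed
  have columns_ordered: "{lo e..<lo e + sz e} \<inter> {lo e'..<lo e' + sz e'} = {}"
    if e: "e \<in> starts" "e' \<in> starts" "e < e'" for e e'
  proof (rule ccontr)
    assume "\<not> ?thesis"
    then obtain j where j: "j \<in> {lo e..<lo e + sz e}" "j \<in> {lo e'..<lo e' + sz e'}" by blast
    obtain i where i: "i < sz e" "A $$ (e + i, j) \<noteq> 0" using column_hit[OF e(1) j(1)] by blast
    obtain i' where i': "i' < sz e'" "A $$ (e' + i', j) \<noteq> 0" using column_hit[OF e(2) j(2)] by blast
    have "e + i < e'" using i(1) end_e[OF e(1)] starts_separated[OF e] by simp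
    moreover have "e' + i' < n" using i'(1) end_e[OF e(2)] by simp
    moreover have "j < n" using j(1) shape[OF e(1)] by simp
    ultimately show False using column_not_across[OF e(2), of "e + i" "e' + i'" j] i(2) i'(2) by simp
  qed
  have rows_disj: "{e..<e + sz e} \<inter> {e'..<e' + sz e'} = {}" if "e \<in> starts" "e' \<in> starts" "e \<noteq> e'" for e e'
    using starts_separated[of e e'] starts_separated[of e' e] that end_e by (cases "e < e'") auto
  have cols_disj: "{lo e..<lo e + sz e} \<inter> {lo e'..<lo e' + sz e'} = {}"
    if "e \<in> starts" "e' \<in> starts" "e \<noteq> e'" for e e'
    using columns_ordered[of e e'] columns_ordered[of e' e] that by (metis inf_commute linorder_neqE_nat)
  have rows: "(\<Union>e\<in>starts. {e..<e + sz e}) = {..<n}"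
  proof
    show "(\<Union>e\<in>starts. {e..<e + sz e}) \<subseteq> {..<n}" using end_e by fastforce
    show "{..<n} \<subseteq> (\<Union>e\<in>starts. {e..<e + sz e})" using starts_cover end_e(1) by fastforce
  qed
  have cols: "(\<Union>e\<in>starts. {lo e..<lo e + sz e}) = {..<n}"
  proof
    show "(\<Union>e\<in>starts. {lo e..<lo e + sz e}) \<subseteq> {..<n}" using shape by fastforce
    show "{..<n} \<subseteq> (\<Union>e\<in>starts. {lo e..<lo e + sz e})"
    proof
      fix j assume "j \<in> {..<n}"
      then have j: "j < n" by simp
      \<comment> \<open>A column sums to 1 and so has a nonzero entry; the group of its row contains
        the column in its range.\<close>
      obtain i where i: "i < n" "A $$ (i, j) \<noteq> 0"
        using dense_asm_column[OF A j] by (metis order_refl power_eq_0_iff zero_neq_neg_one)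
      then have "i \<in> (\<Union>e\<in>starts. {e..<e + sz e})" unfolding rows by simp
      then obtain e where e: "e \<in> starts" "e \<le> i" "i < e + sz e" by auto
      then have "lo e \<le> j \<and> j < lo e + sz e"
        using block[OF e(1), of "i - e" j] i(2) j by (auto split: if_splits)
      then show "j \<in> (\<Union>e\<in>starts. {lo e..<lo e + sz e})" using e(1) by auto
    qed
  qed
  have "finite starts" by (simp add: starts_def)
  moreover have "sz e = 1 \<and> s e + 1 = 1 \<or> 3 \<le> sz e \<and> 2 \<le> s e + 1 \<and> s e + 1 \<le> sz e - 1"
    if "e \<in> starts" for e
    using shape[OF that] by auto
  moreover have "lo e + sz e \<le> n" if "e \<in> starts" for e
    using shape[OF that] by simp
  ultimately show ?thesis
    by (intro that[of starts sz lo "\<lambda>e. s e + 1"] end_e(2) block rows_disj cols_disj rows cols)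
qed

theorem theorem4p4:
  fixes n :: nat and A :: "int mat"
  assumes "dense_asm n A"
  shows "\<exists>(l :: nat) (A' :: nat \<Rightarrow> int mat) (\<sigma> :: nat \<Rightarrow> nat)
            (m :: nat \<Rightarrow> nat) (k :: nat \<Rightarrow> nat) (c :: nat \<Rightarrow> nat).
     (\<forall>r<l. irreducible_dense_asm (A' r)) \<and>
     \<sigma> permutes {..<l} \<and>
     (\<Sum>r<l. m r) = n \<and>
     (\<Sum>s<l. c s) = n \<and>
     (\<forall>r<l. c (\<sigma> r) = m r) \<and>
     (\<forall>r<l. mat_block A m c r (\<sigma> r) = A' r) \<and>
     (\<forall>r<l. \<forall>s<l. s \<noteq> \<sigma> r \<longrightarrow> mat_block A m c r s = 0\<^sub>m (m r) (c s)) \<and>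
     (\<forall>r<l. A' r = F_mat (m r) (k r) \<and>
        (m r = 1 \<and> k r = 1 \<or> 3 \<le> m r \<and> 2 \<le> k r \<and> k r \<le> m r - 1))"
proof -
  have carrier: "A \<in> carrier_mat n n"
    using assms by (simp add: dense_asm_def alternating_sign_matrix_def)
  obtain B sz lo k where finB: "finite B"
    and bounds: "\<And>e. e \<in> B \<Longrightarrow> e + sz e \<le> n" "\<And>e. e \<in> B \<Longrightarrow> lo e + sz e \<le> n"
    and size: "\<And>e. e \<in> B \<Longrightarrow> sz e = 1 \<and> k e = 1 \<or> 3 \<le> sz e \<and> 2 \<le> k e \<and> k e \<le> sz e - 1"
    and block: "\<And>e i j. e \<in> B \<Longrightarrow> i < sz e \<Longrightarrow> j < n \<Longrightarrow> A $$ (e + i, j) =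
      (if lo e \<le> j \<and> j < lo e + sz e then F_mat (sz e) (k e) $$ (i, j - lo e) else 0)"
    and row_disj: "\<And>e e'. e \<in> B \<Longrightarrow> e' \<in> B \<Longrightarrow> e \<noteq> e' \<Longrightarrow> {e..<e + sz e} \<inter> {e'..<e' + sz e'} = {}"
    and col_disj: "\<And>e e'. e \<in> B \<Longrightarrow> e' \<in> B \<Longrightarrow> e \<noteq> e' \<Longrightarrow>
      {lo e..<lo e + sz e} \<inter> {lo e'..<lo e' + sz e'} = {}"
    and row_cover: "(\<Union>e\<in>B. {e..<e + sz e}) = {..<n}"
    and col_cover: "(\<Union>e\<in>B. {lo e..<lo e + sz e}) = {..<n}"
    by (rule dense_asm_block_decomposition[OF assms]) blast
  have sz_pos: "0 < sz e" if "e \<in> B" for e using size[OF that] by auto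
  define l where "l = card B"
  \<comment> \<open>\<open>f\<close> lists the blocks from top to bottom; \<open>g\<close> below
    lists the same blocks from left to right.\<close>
  obtain f where f: "bij_betw f {..<l} B" "\<And>i. i < l \<Longrightarrow> (\<Sum>t<i. sz (f t)) = f i"
    "(\<Sum>t<l. sz (f t)) = n"
    using interval_partition_enumeration[of B sz "\<lambda>e. e", OF finB sz_pos row_disj row_cover]
    unfolding l_def by blast
  obtain g where g: "bij_betw g {..<l} B" "\<And>i. i < l \<Longrightarrow> (\<Sum>t<i. sz (g t)) = lo (g i)"
    "(\<Sum>t<l. sz (g t)) = n"
    using interval_partition_enumeration[of B sz lo, OF finB sz_pos col_disj col_cover]
    unfolding l_def by blast
  have fB: "f r \<in> B" and gB: "g r \<in> B" if "r < l" for r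
    using that f(1) g(1) by (auto simp: bij_betw_def)
  \<comment> \<open>The \<open>r\<close>-th block from the top is the block numbered
    \<open>\<sigma> r\<close> from the left. Outside the range \<open>\<sigma>\<close> is the
    identity, as \<open>permutes\<close> demands.\<close>
  define \<sigma> where "\<sigma> r = (if r < l then inv_into {..<l} g (f r) else r)" for r
  have "bij_betw (inv_into {..<l} g \<circ> f) {..<l} {..<l}"
    by (rule bij_betw_trans[OF f(1) bij_betw_inv_into[OF g(1)]])
  then have "bij_betw \<sigma> {..<l} {..<l}"
    by (rule bij_betw_cong[THEN iffD1, rotated]) (simp add: \<sigma>_def)
  then have perm: "\<sigma> permutes {..<l}"
    by (rule bij_imp_permutes) (simp add: \<sigma>_def)
  have g_\<sigma>: "g (\<sigma> r) = f r" if "r < l" for r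
    using that fB[OF that] g(1) by (simp add: \<sigma>_def bij_betw_inv_into_right)
  have \<sigma>_less: "\<sigma> r < l" if "r < l" for r
    using permutes_in_image[OF perm] that by auto
  define m c where "m r = sz (f r)" and "c s = sz (g s)" for r s
  have mb: "mat_block A m c r s = mat (m r) (c s) (\<lambda>(i, j). A $$ (f r + i, lo (g s) + j))"
    if "r < l" "s < l" for r s
  proof -
    have "block_indices m r = {f r..<f r + m r}" "block_indices c s = {lo (g s)..<lo (g s) + c s}"
      using f(2) g(2) that by (simp_all add: block_indices_def m_def c_def)
    then show ?thesis
      unfolding mat_block_def
      using submatrix_interval[OF carrier, of "f r" "m r" "lo (g s)" "c s"] bounds fB gB that
      by (simp add: m_def c_def)
  qed
  have block_F: "F_mat (sz e) (k e) $$ (i, j) = A $$ (e + i, lo e + j)"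
    if "e \<in> B" "i < sz e" "j < sz e" for e i j
    using block[of e i "lo e + j"] bounds(2)[of e] that by simp
  have F_carrier: "F_mat p q \<in> carrier_mat p p" for p q by (simp add: F_mat_def)
  have main_block: "mat_block A m c r (\<sigma> r) = F_mat (m r) (k (f r))" if "r < l" for r
    unfolding mb[OF that \<sigma>_less[OF that]] using that F_carrier[of "m r" "k (f r)"] block_F[OF fB]
    by (intro eq_matI) (auto simp: m_def c_def g_\<sigma>)
  have zero_block: "mat_block A m c r s = 0\<^sub>m (m r) (c s)" if "r < l" "s < l" "s \<noteq> \<sigma> r" for r s
  proof -
    \<comment> \<open>Since \<open>g\<close> is injective and \<open>g (\<sigma> r) = f r\<close>,
      block column \<open>s\<close> belongs to a block other than \<open>f r\<close>, and the column
      ranges of the two are disjoint.\<close>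
    have "g s \<noteq> f r"
      using that g_\<sigma> \<sigma>_less bij_betw_imp_inj_on[OF g(1)] by (metis inj_onD lessThan_iff)
    then have disj: "{lo (f r)..<lo (f r) + sz (f r)} \<inter> {lo (g s)..<lo (g s) + sz (g s)} = {}"
      using col_disj[OF fB[OF that(1)] gB[OF that(2)]] by simp
    have "A $$ (f r + i, lo (g s) + j) = 0" if ij: "i < sz (f r)" "j < sz (g s)" for i j
    proof -
      have "lo (g s) + j \<notin> {lo (f r)..<lo (f r) + sz (f r)}"
        using disj ij(2) by (metis IntI atLeastLessThan_iff empty_iff le_add1 nat_add_left_cancel_less)
      then show ?thesis
        using block[OF fB[OF \<open>r < l\<close>] ij(1), of "lo (g s) + j"] bounds(2)[OF gB[OF \<open>s < l\<close>]] ij(2) by auto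
    qed
    then show ?thesis unfolding mb[OF that(1,2)] by (intro eq_matI) (auto simp: m_def c_def)
  qed
  \<comment> \<open>Irreducibility includes being a dense ASM; this is inherited from
    \<open>A\<close>, in which the block stands alone in its rows and columns.\<close>
  have dense_F: "dense_asm (sz e) (F_mat (sz e) (k e))" if e: "e \<in> B" for e
  proof (rule isolated_block_dense_asm[OF assms F_carrier bounds[OF e] block_F[OF e]])
    show "A $$ (e + i, j) = 0" if "i < sz e" "j < n" "j \<notin> {lo e..<lo e + sz e}" for i j
      using block[OF e that(1,2)] that(3) by auto
    show "A $$ (i, lo e + j) = 0" if j: "j < sz e" and i: "i < n" "i \<notin> {e..<e + sz e}" for i j
    proof -
      \<comment> \<open>Row \<open>i\<close> belongs to some other block \<open>e'\<close>, whose
        nonzero entries lie in columns outside those of \<open>e\<close>.\<close>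
      have "i \<in> (\<Union>e\<in>B. {e..<e + sz e})" using i(1) row_cover by simp
      then obtain e' where e': "e' \<in> B" "e' \<le> i" "i < e' + sz e'" by auto
      then have "e \<noteq> e'" using i(2) by auto
      then have "{lo e..<lo e + sz e} \<inter> {lo e'..<lo e' + sz e'} = {}" by (rule col_disj[OF e e'(1)])
      then have "lo e + j \<notin> {lo e'..<lo e' + sz e'}" using j by auto
      then show ?thesis
        using block[OF e'(1), of "i - e'" "lo e + j"] e' j bounds(2)[OF e] by auto
    qed
  qed
  have "F_mat 1 1 = 1\<^sub>m 1" by (rule eq_matI) (auto simp: F_mat_def)
  then have "irreducible_dense_asm (F_mat (sz e) (k e))" if "e \<in> B" for e
    unfolding irreducible_dense_asm_def using dense_F[OF that] size[OF that] by metis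
  then have irr: "irreducible_dense_asm (F_mat (m r) (k (f r)))" if "r < l" for r
    using fB[OF that] by (simp add: m_def)
  have size': "m r = 1 \<and> k (f r) = 1 \<or> 3 \<le> m r \<and> 2 \<le> k (f r) \<and> k (f r) \<le> m r - 1" if "r < l" for r
    using size[OF fB[OF that]] by (simp add: m_def)
  show ?thesis
  proof (intro exI conjI allI impI)
    show "irreducible_dense_asm (F_mat (m r) (k (f r)))" if "r < l" for r using irr[OF that] .
    show "\<sigma> permutes {..<l}" by (rule perm)
    show "(\<Sum>r<l. m r) = n" "(\<Sum>s<l. c s) = n" using f(3) g(3) by (simp_all add: m_def c_def)
    show "c (\<sigma> r) = m r" if "r < l" for r using g_\<sigma>[OF that] by (simp add: m_def c_def)
    show "mat_block A m c r (\<sigma> r) = F_mat (m r) (k (f r))" if "r < l" for r using main_block[OF that] .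
    show "mat_block A m c r s = 0\<^sub>m (m r) (c s)" if "r < l" "s < l" "s \<noteq> \<sigma> r" for r s
      using zero_block[OF that] .
    show "F_mat (m r) (k (f r)) = F_mat (m r) (k (f r))" for r ..
    show "m r = 1 \<and> k (f r) = 1 \<or> 3 \<le> m r \<and> 2 \<le> k (f r) \<and> k (f r) \<le> m r - 1" if "r < l" for r
      using size'[OF that] .
  qed
qed

end
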